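(* Let $\mathbb{F}_q$ be a finite field of odd characteristic, let $a,d\in\mathbb{F}_q$ with $ad(a-d)\neq 0$, and let $w(x,y)=dx^2y^2$ on the twisted Edwards curve $E_{a,d}: ax^2+y^2=1+dx^2y^2$. Let $P_1,P_2$ be affine points of $E_{a,d}(\mathbb{F}_q)$ and put $w_0=w(P_2-P_1)$, $w_1=w(P_1)$, $w_2=w(P_2)$, $w_3=w(P_1+P_2)$, $w_4=w(2P_1)$. If $w_1w_2\neq 1$ and $w_1^2\neq 1$, then $$w_4=\frac{4w_1\left((w_1+1)^2-ew_1\right)}{(w_1^2-1)^2},\qquad w_3w_0=\frac{(w_1-w_2)^2}{(w_1w_2-1)^2},$$ and $$w_3+w_0=\frac{2(w_1+w_2)(w_1w_2+1)-4(e-2)w_1w_2}{(w_1w_2-1)^2},$$ where $e=4a/d$.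
   Context: The nonsingular model of $E_{a,d}$ is the curve in $\mathbb{P}^3$ of points $(X:Y:T:Z)$ with $aX^2+Y^2=Z^2+dT^2$ and $XY=ZT$; an affine point $(x,y)$ corresponds to $(x:y:xy:1)$. $E_{a,d}(\mathbb{F}_q)$ is the group of $\mathbb{F}_q$-rational points of this model, with neutral element $\mathcal{O}=(0,1)$, $-(x,y)=(-x,y)$, and (elliptic curve) group law given on affine points, whenever the denominators are nonzero, by $(x_1,y_1)+(x_2,y_2)=\left(\frac{x_1y_2+x_2y_1}{1+dx_1x_2y_1y_2},\frac{y_1y_2-ax_1x_2}{1-dx_1x_2y_1y_2}\right)$. The function $w$ takes finite values exactly at the affine points. *)

theory Defs
  imports Main
begin

section \<open>Projective space\<close>

text \<open>
  Points of \<open>P\<^sup>3(K)\<close> are classes of nonzero vectors of \<open>K\<^sup>4\<close> up to scaling. The coordinates are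
  ordered as \<open>(X : Y : T : Z)\<close>.
\<close>

type_synonym 'a vec4 = "'a \<times> 'a \<times> 'a \<times> 'a"

definition vec4_scale :: "'a::field \<Rightarrow> 'a vec4 \<Rightarrow> 'a vec4" where
  "vec4_scale c = (\<lambda>(X, Y, T, Z). (c * X, c * Y, c * T, c * Z))"

definition proj_rel :: "'a::field vec4 \<Rightarrow> 'a vec4 \<Rightarrow> bool" where
  "proj_rel u v \<longleftrightarrow> u \<noteq> (0, 0, 0, 0) \<and> (\<exists>c. c \<noteq> 0 \<and> v = vec4_scale c u)"

lemma vec4_scale_scale: "vec4_scale c (vec4_scale b u) = vec4_scale (c * b) u"
  by (cases u) (simp add: vec4_scale_def mult.assoc)

lemma vec4_scale_one [simp]: "vec4_scale 1 u = u"
  by (cases u) (simp add: vec4_scale_def)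

lemma vec4_scale_eq_0_iff:
  "c \<noteq> 0 \<Longrightarrow> vec4_scale c u = (0, 0, 0, 0) \<longleftrightarrow> u = (0, 0, 0, 0)"
  by (cases u) (simp add: vec4_scale_def)

lemma proj_rel_scale: "c \<noteq> 0 \<Longrightarrow> u \<noteq> (0, 0, 0, 0) \<Longrightarrow> proj_rel u (vec4_scale c u)"
  unfolding proj_rel_def by blast

lemma proj_rel_refl: "u \<noteq> (0, 0, 0, 0) \<Longrightarrow> proj_rel u u"
  using proj_rel_scale [of 1 u] by simp

lemma part_equivp_proj_rel: "part_equivp (proj_rel :: 'a::field vec4 \<Rightarrow> _)"
proof (rule part_equivpI)
  show "\<exists>x::'a vec4. proj_rel x x"
    using proj_rel_refl [of "(1, 1, 1, 1) :: 'a vec4"] by (intro exI) simp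
  show "symp (proj_rel :: 'a vec4 \<Rightarrow> _)"
  proof (rule sympI)
    fix u v :: "'a vec4" assume "proj_rel u v"
    then obtain c where u: "u \<noteq> (0, 0, 0, 0)" and c: "c \<noteq> 0" and v: "v = vec4_scale c u"
      by (auto simp: proj_rel_def)
    have "u = vec4_scale (inverse c) v" using c v by (simp add: vec4_scale_scale)
    moreover have "v \<noteq> (0, 0, 0, 0)" using u c by (simp add: v vec4_scale_eq_0_iff)
    ultimately show "proj_rel v u"
      using proj_rel_scale [of "inverse c" v] c by simp
  qed
  show "transp (proj_rel :: 'a vec4 \<Rightarrow> _)"
  proof (rule transpI)
    fix u v w :: "'a vec4" assume "proj_rel u v" "proj_rel v w"
    then obtain b c where u: "u \<noteq> (0, 0, 0, 0)" and bc: "b \<noteq> 0" "c \<noteq> 0"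
      and w: "w = vec4_scale c (vec4_scale b u)"
      by (auto simp: proj_rel_def)
    show "proj_rel u w"
      unfolding w vec4_scale_scale using u bc by (intro proj_rel_scale) simp_all
  qed
qed

quotient_type (overloaded) 'a proj3 = "'a::field vec4" / partial: proj_rel
  by (rule part_equivp_proj_rel)


section \<open>The nonsingular model of a twisted Edwards curve\<close>

lift_definition edwards_curve :: "'a::field \<Rightarrow> 'a \<Rightarrow> 'a proj3 \<Rightarrow> bool" is
  "\<lambda>a d (X, Y, T, Z). a * X^2 + Y^2 = Z^2 + d * T^2 \<and> X * Y = Z * T"
proof -
  fix a d :: 'a and u v :: "'a vec4" assume "proj_rel u v"
  then obtain c where c: "c \<noteq> 0" and v: "v = vec4_scale c u"
    by (auto simp: proj_rel_def)
  obtain X Y T Z where u: "u = (X, Y, T, Z)" by (cases u)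
  have "a * (c * X)^2 + (c * Y)^2 = c^2 * (a * X^2 + Y^2)"
    "(c * Z)^2 + d * (c * T)^2 = c^2 * (Z^2 + d * T^2)"
    "c * X * (c * Y) = c^2 * (X * Y)" "c * Z * (c * T) = c^2 * (Z * T)"
    by (simp_all add: power2_eq_square algebra_simps)
  then show "(case u of (X, Y, T, Z) \<Rightarrow> a * X^2 + Y^2 = Z^2 + d * T^2 \<and> X * Y = Z * T) =
     (case v of (X, Y, T, Z) \<Rightarrow> a * X^2 + Y^2 = Z^2 + d * T^2 \<and> X * Y = Z * T)"
    using c by (simp add: u v vec4_scale_def)
qed

definition edwards_points :: "'a::field \<Rightarrow> 'a \<Rightarrow> 'a proj3 set" where
  "edwards_points a d = {P. edwards_curve a d P}"

lift_definition is_affine :: "'a::field proj3 \<Rightarrow> bool" is "\<lambda>(X, Y, T, Z). Z \<noteq> 0"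
  by (auto simp: proj_rel_def vec4_scale_def)

lift_definition affine_point :: "'a::field \<Rightarrow> 'a \<Rightarrow> 'a proj3" is "\<lambda>x y. (x, y, x * y, 1)"
  by (rule proj_rel_refl) simp

definition edwards_zero :: "'a::field proj3" where
  "edwards_zero = affine_point 0 1"

lift_definition edwards_neg :: "'a::field proj3 \<Rightarrow> 'a proj3" is
  "\<lambda>(X, Y, T, Z). (- X, Y, - T, Z)"
  by (auto simp: proj_rel_def vec4_scale_def)

text \<open>
  The affine formulas of the group law, written in the coordinates \<open>(X : Y : T : Z)\<close>, give the
  first law below. It degenerates to the zero vector for some pairs of points; for these the sum is
  given by the second law, which is the homogeneous form of
  \<open>((x\<^sub>1 y\<^sub>1 + x\<^sub>2 y\<^sub>2) / (y\<^sub>1 y\<^sub>2 + a x\<^sub>1 x\<^sub>2), (x\<^sub>1 y\<^sub>1 - x\<^sub>2 y\<^sub>2) / (x\<^sub>1 y\<^sub>2 - x\<^sub>2 y\<^sub>1))\<close>.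
  These two laws (Bernstein and Lange, ``A complete set of addition laws for incomplete Edwards
  curves''; Hisil, Wong, Carter and Dawson, ``Twisted Edwards curves revisited'') describe the
  elliptic curve group law on all of the curve: they never vanish simultaneously there, and they
  agree where both are nonzero.
\<close>

definition edwards_law1 :: "'a::field \<Rightarrow> 'a \<Rightarrow> 'a vec4 \<Rightarrow> 'a vec4 \<Rightarrow> 'a vec4" where
  "edwards_law1 a d = (\<lambda>(X1, Y1, T1, Z1) (X2, Y2, T2, Z2).
    ((X1 * Y2 + X2 * Y1) * (Z1 * Z2 - d * T1 * T2),
     (Y1 * Y2 - a * X1 * X2) * (Z1 * Z2 + d * T1 * T2),
     (X1 * Y2 + X2 * Y1) * (Y1 * Y2 - a * X1 * X2),
     (Z1 * Z2 + d * T1 * T2) * (Z1 * Z2 - d * T1 * T2)))"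

definition edwards_law2 :: "'a::field \<Rightarrow> 'a vec4 \<Rightarrow> 'a vec4 \<Rightarrow> 'a vec4" where
  "edwards_law2 a = (\<lambda>(X1, Y1, T1, Z1) (X2, Y2, T2, Z2).
    ((T1 * Z2 + T2 * Z1) * (X1 * Y2 - X2 * Y1),
     (T1 * Z2 - T2 * Z1) * (Y1 * Y2 + a * X1 * X2),
     (T1 * Z2 + T2 * Z1) * (T1 * Z2 - T2 * Z1),
     (Y1 * Y2 + a * X1 * X2) * (X1 * Y2 - X2 * Y1)))"

lemma edwards_law1_scale:
  "edwards_law1 a d (vec4_scale b u) (vec4_scale c v) =
     vec4_scale (b^2 * c^2) (edwards_law1 a d u v)"
proof -
  obtain X1 Y1 T1 Z1 where u: "u = (X1, Y1, T1, Z1)" by (cases u)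
  obtain X2 Y2 T2 Z2 where v: "v = (X2, Y2, T2, Z2)" by (cases v)
  have "b * X1 * (c * Y2) + c * X2 * (b * Y1) = (b * c) * (X1 * Y2 + X2 * Y1)"
    "b * Z1 * (c * Z2) - d * (b * T1) * (c * T2) = (b * c) * (Z1 * Z2 - d * T1 * T2)"
    "b * Y1 * (c * Y2) - a * (b * X1) * (c * X2) = (b * c) * (Y1 * Y2 - a * X1 * X2)"
    "b * Z1 * (c * Z2) + d * (b * T1) * (c * T2) = (b * c) * (Z1 * Z2 + d * T1 * T2)"
    by (simp_all add: algebra_simps)
  moreover have "(b * c * r) * (b * c * s) = b^2 * c^2 * (r * s)" for r s
    by (simp add: power2_eq_square mult_ac)
  ultimately show ?thesis
    unfolding u v edwards_law1_def vec4_scale_def prod.case by (simp only:)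
qed

lemma edwards_law2_scale:
  "edwards_law2 a (vec4_scale b u) (vec4_scale c v) =
     vec4_scale (b^2 * c^2) (edwards_law2 a u v)"
proof -
  obtain X1 Y1 T1 Z1 where u: "u = (X1, Y1, T1, Z1)" by (cases u)
  obtain X2 Y2 T2 Z2 where v: "v = (X2, Y2, T2, Z2)" by (cases v)
  have "b * T1 * (c * Z2) + c * T2 * (b * Z1) = (b * c) * (T1 * Z2 + T2 * Z1)"
    "b * T1 * (c * Z2) - c * T2 * (b * Z1) = (b * c) * (T1 * Z2 - T2 * Z1)"
    "b * Y1 * (c * Y2) + a * (b * X1) * (c * X2) = (b * c) * (Y1 * Y2 + a * X1 * X2)"
    "b * X1 * (c * Y2) - c * X2 * (b * Y1) = (b * c) * (X1 * Y2 - X2 * Y1)"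
    by (simp_all add: algebra_simps)
  moreover have "(b * c * r) * (b * c * s) = b^2 * c^2 * (r * s)" for r s
    by (simp add: power2_eq_square mult_ac)
  ultimately show ?thesis
    unfolding u v edwards_law2_def vec4_scale_def prod.case by (simp only:)
qed

text \<open>The value in the last case is irrelevant, since that case does not occur on the curve.\<close>

lift_definition edwards_add :: "'a::field \<Rightarrow> 'a \<Rightarrow> 'a proj3 \<Rightarrow> 'a proj3 \<Rightarrow> 'a proj3" is
  "\<lambda>a d u v. if edwards_law1 a d u v \<noteq> (0, 0, 0, 0) then edwards_law1 a d u v
     else if edwards_law2 a u v \<noteq> (0, 0, 0, 0) then edwards_law2 a u v
     else (0, 1, 0, 1)"
proof -
  fix a d :: 'a and u u' v v' :: "'a vec4"
  assume "proj_rel u u'" "proj_rel v v'"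
  then obtain b c where b: "b \<noteq> 0" "u' = vec4_scale b u" and c: "c \<noteq> 0" "v' = vec4_scale c v"
    by (auto simp: proj_rel_def)
  have bc: "b^2 * c^2 \<noteq> 0" using b c by simp
  have "proj_rel (0, 1, 0, 1) (0, 1, 0, 1 :: 'a)"
    by (rule proj_rel_refl) simp
  then show "proj_rel
      (if edwards_law1 a d u v \<noteq> (0, 0, 0, 0) then edwards_law1 a d u v
       else if edwards_law2 a u v \<noteq> (0, 0, 0, 0) then edwards_law2 a u v else (0, 1, 0, 1))
      (if edwards_law1 a d u' v' \<noteq> (0, 0, 0, 0) then edwards_law1 a d u' v'
       else if edwards_law2 a u' v' \<noteq> (0, 0, 0, 0) then edwards_law2 a u' v' else (0, 1, 0, 1))"
    unfolding b c edwards_law1_scale edwards_law2_scale vec4_scale_eq_0_iff [OF bc]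
    using proj_rel_scale [OF bc] by presburger
qed

definition edwards_diff :: "'a::field \<Rightarrow> 'a \<Rightarrow> 'a proj3 \<Rightarrow> 'a proj3 \<Rightarrow> 'a proj3" where
  "edwards_diff a d P Q = edwards_add a d P (edwards_neg Q)"

definition edwards_double :: "'a::field \<Rightarrow> 'a \<Rightarrow> 'a proj3 \<Rightarrow> 'a proj3" where
  "edwards_double a d P = edwards_add a d P P"

text \<open>
  The function \<open>w = d x\<^sup>2 y\<^sup>2\<close>, where \<open>x y = T / Z\<close>; the value \<open>None\<close> stands for \<open>\<infinity>\<close>.
\<close>

lift_definition edwards_w :: "'a::field \<Rightarrow> 'a proj3 \<Rightarrow> 'a option" is
  "\<lambda>d (X, Y, T, Z). if Z = 0 then None else Some (d * (T / Z)^2)"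
proof -
  fix d :: 'a and u v :: "'a vec4" assume "proj_rel u v"
  then obtain c where c: "c \<noteq> 0" and v: "v = vec4_scale c u"
    by (auto simp: proj_rel_def)
  obtain X Y T Z where u: "u = (X, Y, T, Z)" by (cases u)
  show "(case u of (X, Y, T, Z) \<Rightarrow> if Z = 0 then None else Some (d * (T / Z)^2)) =
      (case v of (X, Y, T, Z) \<Rightarrow> if Z = 0 then None else Some (d * (T / Z)^2))"
    using c by (simp add: u v vec4_scale_def)
qed


section \<open>Agreement with the affine description\<close>

lemma edwards_points_affine_iff:
  "P \<in> edwards_points a d \<and> is_affine P \<longleftrightarrow>
     (\<exists>x y. P = affine_point x y \<and> a * x^2 + y^2 = 1 + d * x^2 * y^2)"
proof
  assume "P \<in> edwards_points a d \<and> is_affine P"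
  then have "edwards_curve a d P" "is_affine P" by (simp_all add: edwards_points_def)
  then show "\<exists>x y. P = affine_point x y \<and> a * x^2 + y^2 = 1 + d * x^2 * y^2"
  proof transfer
    fix a d :: 'a and u :: "'a vec4"
    obtain X Y T Z where u: "u = (X, Y, T, Z)" by (cases u)
    assume "case u of (X, Y, T, Z) \<Rightarrow> a * X^2 + Y^2 = Z^2 + d * T^2 \<and> X * Y = Z * T"
      "case u of (X, Y, T, Z) \<Rightarrow> Z \<noteq> 0"
    then have Z: "Z \<noteq> 0" and eq: "a * X^2 + Y^2 = Z^2 + d * T^2" "X * Y = Z * T"
      by (simp_all add: u)
    have T: "X / Z * (Y / Z) = T / Z" using eq(2) Z by simp
    have "a * (X / Z)^2 + (Y / Z)^2 = (a * X^2 + Y^2) / Z^2"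
      by (simp add: power_divide add_divide_distrib)
    also have "\<dots> = 1 + d * (T / Z)^2"
      using Z by (simp add: eq(1) power_divide add_divide_distrib)
    also have "\<dots> = 1 + d * (X / Z)^2 * (Y / Z)^2"
      unfolding T [symmetric] by (simp only: power_mult_distrib mult.assoc)
    finally have "a * (X / Z)^2 + (Y / Z)^2 = 1 + d * (X / Z)^2 * (Y / Z)^2" .
    moreover have "proj_rel u (X / Z, Y / Z, X / Z * (Y / Z), 1)"
      unfolding proj_rel_def T u using Z
      by (auto simp: vec4_scale_def intro!: exI[of _ "1 / Z"])
    ultimately show "\<exists>x y. proj_rel u (x, y, x * y, 1) \<and>
        a * x^2 + y^2 = 1 + d * x^2 * y^2" by blast
  qed
next
  assume "\<exists>x y. P = affine_point x y \<and> a * x^2 + y^2 = 1 + d * x^2 * y^2"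
  then obtain x y where P: "P = affine_point x y"
    and eq: "a * x^2 + y^2 = 1 + d * x^2 * y^2" by blast
  have "edwards_curve a d (affine_point x y)"
    using eq by transfer (simp add: power_mult_distrib mult.assoc)
  moreover have "is_affine (affine_point x y)" by transfer simp
  ultimately show "P \<in> edwards_points a d \<and> is_affine P"
    by (simp add: P edwards_points_def)
qed

lemma edwards_w_affine [simp]: "edwards_w d (affine_point x y) = Some (d * x^2 * y^2)"
  by transfer (simp add: power_mult_distrib)

lemma edwards_w_finite_iff: "edwards_w d P \<noteq> None \<longleftrightarrow> is_affine P"
  by transfer auto

lemma edwards_neg_affine: "edwards_neg (affine_point x y) = affine_point (- x) y"
  by transfer (simp add: proj_rel_refl)

lemma edwards_add_affine:
  assumes "1 + d * x1 * x2 * y1 * y2 \<noteq> 0" "1 - d * x1 * x2 * y1 * y2 \<noteq> 0"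
  shows "edwards_add a d (affine_point x1 y1) (affine_point x2 y2) =
    affine_point ((x1 * y2 + x2 * y1) / (1 + d * x1 * x2 * y1 * y2))
                 ((y1 * y2 - a * x1 * x2) / (1 - d * x1 * x2 * y1 * y2))"
  using assms
proof transfer
  fix d x1 x2 y1 y2 a :: 'a
  let ?G = "1 + d * x1 * x2 * y1 * y2" and ?F = "1 - d * x1 * x2 * y1 * y2"
  let ?A = "x1 * y2 + x2 * y1" and ?B = "y1 * y2 - a * x1 * x2"
  assume nz: "?G \<noteq> 0" "?F \<noteq> 0"
  have law: "edwards_law1 a d (x1, y1, x1 * y1, 1) (x2, y2, x2 * y2, 1) =
      (?A * ?F, ?B * ?G, ?A * ?B, ?G * ?F)"
    by (simp add: edwards_law1_def mult_ac)
  have "proj_rel (?A * ?F, ?B * ?G, ?A * ?B, ?G * ?F) (?A / ?G, ?B / ?F, ?A / ?G * (?B / ?F), 1)"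
    unfolding proj_rel_def using nz
    by (auto simp: vec4_scale_def simp del: times_divide_times_eq intro!: exI[of _ "1 / (?G * ?F)"])
  then show "proj_rel
      (if edwards_law1 a d (x1, y1, x1 * y1, 1) (x2, y2, x2 * y2, 1) \<noteq> (0, 0, 0, 0)
       then edwards_law1 a d (x1, y1, x1 * y1, 1) (x2, y2, x2 * y2, 1)
       else if edwards_law2 a (x1, y1, x1 * y1, 1) (x2, y2, x2 * y2, 1) \<noteq> (0, 0, 0, 0)
       then edwards_law2 a (x1, y1, x1 * y1, 1) (x2, y2, x2 * y2, 1) else (0, 1, 0, 1))
      (?A / ?G, ?B / ?F, ?A / ?G * (?B / ?F), 1)"
    using nz unfolding law by simp
qed

end

(*
  On affine points put s = x y and u = y^2 - a x^2. Then w = d s^2, the numerators of the addition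
  formulas multiply to s1 u2 + s2 u1, and the product of their denominators is 1 - w1 w2.
  Negating a point changes the sign of s and fixes u, so that
  w(P2 + P1) and w(P2 - P1) are d (s2 u1 + s1 u2)^2 and d (s2 u1 - s1 u2)^2 over (1 - w1 w2)^2.
  The curve equation gives u^2 = (1 + w)^2 - e w, which turns the symmetric functions of these
  values into rational functions of w1 and w2.
*)

theory Submission
  imports Defs
begin

text \<open>The hypothesis is exactly what keeps both denominators of the affine addition formula
  nonzero, so the sum is again affine.\<close>

lemma edwards_w_add_affine:
  fixes a d x1 y1 x2 y2 :: "'a::field"
  defines "u1 \<equiv> y1^2 - a * x1^2" and "u2 \<equiv> y2^2 - a * x2^2"
  assumes "(d * x1^2 * y1^2) * (d * x2^2 * y2^2) \<noteq> 1"
  shows "edwards_w d (edwards_add a d (affine_point x1 y1) (affine_point x2 y2)) =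
    Some (d * (x1 * y1 * u2 + x2 * y2 * u1)^2 /
      ((d * x1^2 * y1^2) * (d * x2^2 * y2^2) - 1)^2)"
proof -
  \<comment> \<open>The denominators are \<open>1 + m\<close> and \<open>1 - m\<close>; since
    \<open>m^2\<close> is the product of the two w-values, that product differs from 1 iff neither
    vanishes.\<close>
  define m where "m = d * x1 * x2 * y1 * y2"
  have mm: "(d * x1^2 * y1^2) * (d * x2^2 * y2^2) = m^2"
    by (simp add: m_def power2_eq_square mult_ac)
  have "(1 + m) * (1 - m) \<noteq> 0"
    using assms(3) unfolding mm by (auto simp: algebra_simps power2_eq_square)
  then have nz: "1 + m \<noteq> 0" "1 - m \<noteq> 0"
    by auto
  have num: "(x1 * y2 + x2 * y1) * (y1 * y2 - a * x1 * x2) = x1 * y1 * u2 + x2 * y2 * u1"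
    by (simp add: u1_def u2_def algebra_simps power2_eq_square)
  have den: "((1 + m) * (1 - m))^2 = (m^2 - 1)^2"
    by algebra
  have "d * ((x1 * y2 + x2 * y1) / (1 + m))^2 * ((y1 * y2 - a * x1 * x2) / (1 - m))^2
      = d * ((x1 * y2 + x2 * y1) * (y1 * y2 - a * x1 * x2))^2 / ((1 + m) * (1 - m))^2"
    by (simp add: power_divide power_mult_distrib)
  then show ?thesis
    unfolding mm using edwards_add_affine [of d x1 x2 y1 y2 a] nz
    by (simp add: num den flip: m_def)
qed

text \<open>This is \<open>(A - B)^2 = (A + B)^2 - 4 * A * B\<close> with \<open>A = y^2\<close> and
  \<open>B = a * x^2\<close>, where the curve equation gives \<open>A + B = 1 + w\<close>.\<close>

lemma edwards_curve_u_square: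
  fixes a d x y :: "'a::field"
  assumes "d \<noteq> 0" and "a * x^2 + y^2 = 1 + d * x^2 * y^2" and "w = d * x^2 * y^2"
  shows "(y^2 - a * x^2)^2 = (w + 1)^2 - 4 * a / d * w"
proof -
  have "4 * a / d * w = 4 * a * x^2 * y^2"
    using assms(1,3) by simp
  moreover have "(y^2 - a * x^2)^2 = (a * x^2 + y^2)^2 - 4 * a * x^2 * y^2"
    by algebra
  ultimately show ?thesis
    using assms(2,3) by (simp add: add.commute)
qed

theorem proposition1:
  fixes a d e w1 w2 :: "'a::{field,finite}"
    and P1 P2 :: "'a proj3"
  assumes "odd CHAR('a)"
    and "a * d * (a - d) \<noteq> 0"
    and "P1 \<in> edwards_points a d" and "is_affine P1"
    and "P2 \<in> edwards_points a d" and "is_affine P2"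
    and "edwards_w d P1 = Some w1"
    and "edwards_w d P2 = Some w2"
    and "w1 * w2 \<noteq> 1"
    and "w1^2 \<noteq> 1"
    and "e = 4 * a / d"
  shows "\<exists>w0 w3 w4.
      edwards_w d (edwards_diff a d P2 P1) = Some w0 \<and>
      edwards_w d (edwards_add a d P1 P2) = Some w3 \<and>
      edwards_w d (edwards_double a d P1) = Some w4 \<and>
      w4 = 4 * w1 * ((w1 + 1)^2 - e * w1) / (w1^2 - 1)^2 \<and>
      w3 * w0 = (w1 - w2)^2 / (w1 * w2 - 1)^2 \<and>
      w3 + w0 = (2 * (w1 + w2) * (w1 * w2 + 1) - 4 * (e - 2) * w1 * w2) / (w1 * w2 - 1)^2"
proof -
  obtain x1 y1 where P1: "P1 = affine_point x1 y1" and c1: "a * x1^2 + y1^2 = 1 + d * x1^2 * y1^2"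
    using assms(3,4) edwards_points_affine_iff by blast
  obtain x2 y2 where P2: "P2 = affine_point x2 y2" and c2: "a * x2^2 + y2^2 = 1 + d * x2^2 * y2^2"
    using assms(5,6) edwards_points_affine_iff by blast
  have w1: "w1 = d * x1^2 * y1^2" and w2: "w2 = d * x2^2 * y2^2"
    using assms(7,8) by (simp_all add: P1 P2)
  have d: "d \<noteq> 0"
    using assms(2) by auto
  define s1 s2 where "s1 = x1 * y1" and "s2 = x2 * y2"
  define u1 u2 where "u1 = y1^2 - a * x1^2" and "u2 = y2^2 - a * x2^2"
  have ws: "w1 = d * s1^2" "w2 = d * s2^2"
    by (simp_all add: w1 w2 s1_def s2_def power_mult_distrib)
  have u1: "u1^2 = (w1 + 1)^2 - e * w1" and u2: "u2^2 = (w2 + 1)^2 - e * w2"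
    using edwards_curve_u_square [OF d c1 w1] edwards_curve_u_square [OF d c2 w2]
    by (simp_all add: u1_def u2_def assms(11))
  define D where "D = w1 * w2 - 1"
  have D: "D \<noteq> 0"
    using assms(9) by (simp add: D_def)
  define w0 where "w0 = d * (s2 * u1 - s1 * u2)^2 / D^2"
  define w3 where "w3 = d * (s1 * u2 + s2 * u1)^2 / D^2"
  define w4 where "w4 = d * (2 * s1 * u1)^2 / (w1^2 - 1)^2"
  have "edwards_w d (edwards_diff a d P2 P1) = Some w0"
    \<comment> \<open>Subtracting \<open>P1\<close> means adding the point with \<open>- x1\<close>:
      \<open>s1\<close> becomes \<open>- s1\<close>, while \<open>u1\<close> and \<open>w1\<close>
      stay.\<close>
    using edwards_w_add_affine [of d x2 y2 "- x1" y1 a] assms(9)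
    unfolding edwards_diff_def P1 P2 edwards_neg_affine w0_def D_def
    by (simp add: s1_def s2_def u1_def u2_def w1 w2 mult.commute)
  moreover have "edwards_w d (edwards_add a d P1 P2) = Some w3"
    using edwards_w_add_affine [of d x1 y1 x2 y2 a] assms(9)
    unfolding P1 P2 w3_def D_def
    by (simp add: s1_def s2_def u1_def u2_def w1 w2)
  moreover have "edwards_w d (edwards_double a d P1) = Some w4"
  proof -
    have "s1 * u1 + s1 * u1 = 2 * s1 * u1"
      by simp
    then show ?thesis
      \<comment> \<open>With equal summands the nonvanishing condition reads
        \<open>w1 * w1 \<noteq> 1\<close>.\<close>
      using edwards_w_add_affine [of d x1 y1 x1 y1 a, folded w1 u1_def s1_def] assms(10)
      by (simp add: edwards_double_def P1 w4_def power2_eq_square)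
  qed
  moreover have "w4 = 4 * w1 * ((w1 + 1)^2 - e * w1) / (w1^2 - 1)^2"
    unfolding w4_def u1 [symmetric] by (simp add: ws(1) power_mult_distrib)
  moreover have "w3 * w0 = (w1 - w2)^2 / D^2"
  proof -
    \<comment> \<open>Difference of squares: the two numerator roots multiply to
      \<open>s2^2 * u1^2 - s1^2 * u2^2\<close>, and \<open>d\<close> turns each \<open>s^2\<close>
      into w.\<close>
    have "w3 * w0 = (w2 * u1^2 - w1 * u2^2)^2 / (D^2 * D^2)"
    proof -
      have "d * (s1 * u2 + s2 * u1)^2 * (d * (s2 * u1 - s1 * u2)^2) = (w2 * u1^2 - w1 * u2^2)^2"
        unfolding ws by algebra
      then show ?thesis
        by (simp add: w3_def w0_def)
    qed
    \<comment> \<open>The terms in \<open>e\<close> cancel here, and the factor \<open>D\<close>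
      then removes one \<open>D^2\<close> from the denominator.\<close>
    also have "w2 * u1^2 - w1 * u2^2 = (w1 - w2) * D"
      unfolding u1 u2 D_def by algebra
    finally show ?thesis
      by (simp only: power_mult_distrib mult_divide_mult_cancel_right [OF power_not_zero [OF D]])
  qed
  moreover have "w3 + w0 = (2 * (w1 + w2) * (w1 * w2 + 1) - 4 * (e - 2) * w1 * w2) / D^2"
  proof -
    \<comment> \<open>The mixed terms in \<open>s1 * s2 * u1 * u2\<close> cancel, leaving only
      squares.\<close>
    have "d * (s1 * u2 + s2 * u1)^2 + d * (s2 * u1 - s1 * u2)^2 = 2 * (w1 * u2^2 + w2 * u1^2)"
      unfolding ws by algebra
    also have "\<dots> = 2 * (w1 + w2) * (w1 * w2 + 1) - 4 * (e - 2) * w1 * w2"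
      unfolding u1 u2 by algebra
    finally show ?thesis
      by (simp add: w3_def w0_def flip: add_divide_distrib)
  qed
  ultimately show ?thesis
    unfolding D_def by blast
qed

end
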